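(* Let $A\in\mathbb{R}^{n\times n}$, $B_1\in\mathbb{R}^{n\times m_1}$, $B_2\in\mathbb{R}^{n\times m_2}$, $C_1\in\mathbb{R}^{p_1\times n}$, $D_{11}\in\mathbb{R}^{p_1\times m_1}$, $D_{12}\in\mathbb{R}^{p_1\times m_2}$, let $N_0=n+p_1+m_1$, and suppose that $\begin{pmatrix}B_2\\ D_{12}\end{pmatrix}$ has full column rank. Consider the dual problem $$\sup\ 2(B_1^T\bullet Z_{31}+D_{11}^T\bullet Z_{32})$$ subject to $$I_{p_1}\bullet Z_{22}+I_{m_1}\bullet Z_{33}=1,\qquad B_2^TZ_{11}+D_{12}^TZ_{21}=O_{m_2\times n},$$ $$\mathrm{He}(A^TZ_{11}+C_1^TZ_{21})\in\mathbb{S}^n_+,\qquad \begin{pmatrix}Z_{11}&Z_{21}^T&Z_{31}^T\\ Z_{21}&Z_{22}&Z_{32}^T\\ Z_{31}&Z_{32}&Z_{33}\end{pmatrix}\in\mathbb{S}^{N_0}_+ ,$$ with decision variables $Z_{11}$ ($n\times n$), $Z_{21}$ ($p_1\times n$), $Z_{22}$ ($p_1\times p_1$), $Z_{31}$ ($m_1\times n$), $Z_{32}$ ($m_1\times p_1$), $Z_{33}$ ($m_1\times m_1$). (1) If $D_{12}$ does not have full column rank, then the dual problem is not strongly feasible. (2) If $D_{12}$ has full column rank, then the dual problem is not strongly feasible if and only if the subsystem $C_1(sI-A)^{-1}B_2+D_{12}$ has an invariant zero with nonpositive real part.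
   Context: $\mathbb{S}^k_+$ and $\mathbb{S}^k_{++}$ denote the sets of $k\times k$ real symmetric positive semidefinite and positive definite matrices; $O_{k\times \ell}$ is the zero matrix; $\mathrm{He}(M)=M+M^T$; $P\bullet Q=\mathrm{Trace}(PQ^T)$ for real matrices of the same size. The dual problem is strongly feasible if there exist $Z_{ij}$ satisfying the two equality constraints and such that both semidefinite constraints hold strictly: $\mathrm{He}(A^TZ_{11}+C_1^TZ_{21})\in\mathbb{S}^n_{++}$ and the $3\times 3$ block matrix lies in $\mathbb{S}^{N_0}_{++}$. An invariant zero of the subsystem (with realization $(A,B_2,C_1,D_{12})$) is a $\lambda\in\mathbb{C}$ such that $\mathrm{rank}\begin{pmatrix}A-\lambda I_n&B_2\\ C_1&D_{12}\end{pmatrix}<n+m_2$ (rank over $\mathbb{C}$). *)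

theory Defs
  imports "HOL-Analysis.Analysis"
begin

text \<open>
  A real \<open>r \<times> c\<close> matrix has type \<open>real^'c^'r\<close>, so the row index type comes last.
  Block matrices are indexed by sum types; a block matrix with row blocks of sizes
  \<open>n\<close>, \<open>p\<^sub>1\<close>, \<open>m\<^sub>1\<close> has row index type \<open>'n + 'p + 'm1\<close>, of cardinality \<open>n + p\<^sub>1 + m\<^sub>1\<close>.
\<close>

definition hcat :: "'a^'c^'r \<Rightarrow> 'a^'d^'r \<Rightarrow> 'a^('c + 'd)^'r" where
  "hcat M N = (\<chi> i j. case j of Inl k \<Rightarrow> M $ i $ k | Inr k \<Rightarrow> N $ i $ k)"

definition vcat :: "'a^'c^'r \<Rightarrow> 'a^'c^'s \<Rightarrow> 'a^'c^('r + 's)" where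
  "vcat M N = (\<chi> i. case i of Inl k \<Rightarrow> M $ k | Inr k \<Rightarrow> N $ k)"

definition psd :: "(real^'k^'k) set" where
  "psd = {M. transpose M = M \<and> (\<forall>x. x \<bullet> (M *v x) \<ge> 0)}"

definition pd :: "(real^'k^'k) set" where
  "pd = {M. transpose M = M \<and> (\<forall>x. x \<noteq> 0 \<longrightarrow> x \<bullet> (M *v x) > 0)}"

definition He :: "real^'k^'k \<Rightarrow> real^'k^'k" where
  "He M = M + transpose M"

definition mdot :: "real^'c^'r \<Rightarrow> real^'c^'r \<Rightarrow> real" where
  "mdot P Q = trace (P ** transpose Q)"

definition full_column_rank :: "real^'c^'r \<Rightarrow> bool" where
  "full_column_rank M \<longleftrightarrow> rank M = CARD('c)"

definition invariant_zero ::
  "real^'n^'n \<Rightarrow> real^'m^'n \<Rightarrow> real^'n^'p \<Rightarrow> real^'m^'p \<Rightarrow> complex \<Rightarrow> bool" where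
  "invariant_zero A B C D z \<longleftrightarrow>
     rank (vcat (hcat (map_matrix of_real A - mat z) (map_matrix of_real B))
                (hcat (map_matrix of_real C) (map_matrix of_real D)) :: complex^('n + 'm)^('n + 'p))
       < CARD('n) + CARD('m)"

definition dual_objective ::
  "real^'m1^'n \<Rightarrow> real^'m1^'p \<Rightarrow> real^'n^'m1 \<Rightarrow> real^'p^'m1 \<Rightarrow> real" where
  "dual_objective B1 D11 Z31 Z32 = 2 * (mdot (transpose B1) Z31 + mdot (transpose D11) Z32)"

definition dual_equalities ::
  "real^'m2^'n \<Rightarrow> real^'m2^'p \<Rightarrow>
   real^'n^'n \<Rightarrow> real^'n^'p \<Rightarrow> real^'p^'p \<Rightarrow> real^'m1^'m1 \<Rightarrow> bool" where
  "dual_equalities B2 D12 Z11 Z21 Z22 Z33 \<longleftrightarrow>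
     mdot (mat 1) Z22 + mdot (mat 1) Z33 = 1 \<and>
     transpose B2 ** Z11 + transpose D12 ** Z21 = 0"

definition dual_lyap ::
  "real^'n^'n \<Rightarrow> real^'n^'p \<Rightarrow> real^'n^'n \<Rightarrow> real^'n^'p \<Rightarrow> real^'n^'n" where
  "dual_lyap A C1 Z11 Z21 = He (transpose A ** Z11 + transpose C1 ** Z21)"

definition dual_block ::
  "real^'n^'n \<Rightarrow> real^'n^'p \<Rightarrow> real^'p^'p \<Rightarrow> real^'n^'m1 \<Rightarrow> real^'p^'m1 \<Rightarrow> real^'m1^'m1
   \<Rightarrow> real^('n + 'p + 'm1)^('n + 'p + 'm1)" where
  "dual_block Z11 Z21 Z22 Z31 Z32 Z33 =
     vcat (hcat Z11 (hcat (transpose Z21) (transpose Z31)))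
    (vcat (hcat Z21 (hcat Z22             (transpose Z32)))
          (hcat Z31 (hcat Z32             Z33)))"

definition dual_feasible ::
  "real^'n^'n \<Rightarrow> real^'m2^'n \<Rightarrow> real^'n^'p \<Rightarrow> real^'m2^'p \<Rightarrow>
   real^'n^'n \<Rightarrow> real^'n^'p \<Rightarrow> real^'p^'p \<Rightarrow> real^'n^'m1 \<Rightarrow> real^'p^'m1 \<Rightarrow> real^'m1^'m1 \<Rightarrow> bool"
  where
  "dual_feasible A B2 C1 D12 Z11 Z21 Z22 Z31 Z32 Z33 \<longleftrightarrow>
     dual_equalities B2 D12 Z11 Z21 Z22 Z33 \<and>
     dual_lyap A C1 Z11 Z21 \<in> psd \<and>
     dual_block Z11 Z21 Z22 Z31 Z32 Z33 \<in> psd"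

text \<open>The optimal value is extended-real: the supremum may be infinite, or over the empty set.\<close>

definition dual_value ::
  "real^'n^'n \<Rightarrow> real^'m1^'n \<Rightarrow> real^'m2^'n \<Rightarrow> real^'n^'p \<Rightarrow> real^'m1^'p \<Rightarrow> real^'m2^'p \<Rightarrow> ereal"
  where
  "dual_value A B1 B2 C1 D11 D12 =
     Sup {ereal (dual_objective B1 D11 Z31 Z32) | Z11 Z21 Z22 Z31 Z32 Z33.
            dual_feasible A B2 C1 D12 Z11 Z21 Z22 Z31 Z32 Z33}"

text \<open>
  The data \<open>B1\<close> and \<open>D11\<close> occur only in the objective of the dual problem, so strong
  feasibility depends on them only through their dimensions.
\<close>

definition dual_strongly_feasible ::
  "real^'n^'n \<Rightarrow> real^'m1^'n \<Rightarrow> real^'m2^'n \<Rightarrow> real^'n^'p \<Rightarrow> real^'m1^'p \<Rightarrow> real^'m2^'p \<Rightarrow> bool"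
  where
  "dual_strongly_feasible A B1 B2 C1 D11 D12 \<longleftrightarrow>
     (\<exists>Z11 Z21 Z22 (Z31 :: real^'n^'m1) Z32 Z33.
        dual_equalities B2 D12 Z11 Z21 Z22 Z33 \<and>
        dual_lyap A C1 Z11 Z21 \<in> pd \<and>
        dual_block Z11 Z21 Z22 Z31 Z32 Z33 \<in> pd)"

end

theory Submission
  imports Defs "HOL-Computational_Algebra.Fundamental_Theorem_Algebra"
begin

text \<open>
  By a Schur complement and scaling, strong feasibility amounts to finding \<open>X\<close> positive definite
  and \<open>Y\<close> with \<open>B\<^sub>2\<^sup>T X + D\<^sub>1\<^sub>2\<^sup>T Y = 0\<close> and \<open>He (A\<^sup>T X + C\<^sub>1\<^sup>T Y)\<close> positive definite. Evaluating the
  second form at the state part of a zero direction for \<open>z\<close> gives \<open>2 Re z\<close> times a positive number,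
  so zeros in the closed left half plane exclude this. Conversely, let \<open>G D\<^sub>1\<^sub>2 = I\<close>,
  \<open>W = A - B\<^sub>2 G C\<^sub>1\<close> and \<open>E = C\<^sub>1 - D\<^sub>1\<^sub>2 G C\<^sub>1\<close>. If no such \<open>X\<close>, \<open>Y\<close> exist, a separating hyperplane yields a nonzero
  positive semidefinite \<open>Q\<close> with \<open>E Q = 0\<close> and \<open>W Q + Q W\<^sup>T\<close> negative semidefinite. Then the range
  of \<open>Q\<close> is \<open>W\<close>-invariant, and an eigenvector of \<open>W\<close> in its complexification has an eigenvalue with
  nonpositive real part, which is an invariant zero.
\<close>

section \<open>Block matrices and rank\<close>

definition pi1 :: "'a^('c::finite + 'd::finite) \<Rightarrow> 'a^'c" where
  "pi1 x = (\<chi> i. x $ Inl i)"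

definition pi2 :: "'a^('c::finite + 'd::finite) \<Rightarrow> 'a^'d" where
  "pi2 x = (\<chi> i. x $ Inr i)"

definition vpair :: "'a^'c \<Rightarrow> 'a^'d \<Rightarrow> 'a^('c::finite + 'd::finite)" where
  "vpair x y = (\<chi> i. case i of Inl k \<Rightarrow> x $ k | Inr k \<Rightarrow> y $ k)"

lemma pi_nth [simp]: "pi1 x $ i = x $ Inl i" "pi2 x $ j = x $ Inr j"
  by (simp_all add: pi1_def pi2_def)

lemma pi_vpair [simp]: "pi1 (vpair x y) = x" "pi2 (vpair x y) = y"
  by (simp_all add: vec_eq_iff vpair_def)

lemma vec_sum_eq_iff: "x = y \<longleftrightarrow> pi1 x = pi1 y \<and> pi2 x = pi2 y"
  by (simp add: vec_eq_iff split_sum_all)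

lemma pi_0 [simp]: "pi1 0 = 0" "pi2 0 = 0"
  by (simp_all add: vec_eq_iff)

lemma pi_vcat_mult [simp]:
  "pi1 (vcat M N *v x) = M *v x" "pi2 (vcat M N *v x) = N *v x"
  by (simp_all add: vec_eq_iff vcat_def matrix_vector_mult_def)

lemma sum_UNIV_Plus:
  "(\<Sum>i\<in>UNIV. f i) = (\<Sum>i\<in>UNIV. f (Inl i)) + (\<Sum>j\<in>UNIV. f (Inr j))"
  for f :: "'a::finite + 'b::finite \<Rightarrow> 'c::comm_monoid_add"
  by (simp add: UNIV_Plus_UNIV[symmetric] sum.Plus del: UNIV_Plus_UNIV)

lemma hcat_mult: "hcat M N *v x = M *v pi1 x + N *v pi2 x"
  by (simp add: vec_eq_iff hcat_def matrix_vector_mult_def sum_UNIV_Plus)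

lemma inner_vec_sum: "x \<bullet> y = pi1 x \<bullet> pi1 y + pi2 x \<bullet> pi2 y"
  for x :: "real^('c::finite + 'd::finite)"
  by (simp add: inner_vec_def sum_UNIV_Plus)

text \<open>A left inverse exists exactly when the rows span the whole space, and the rank is the
  dimension of the row span. The field stays general because real data and the complex pencil are
  both treated.\<close>

lemma left_inverse_iff_rank:
  "(\<exists>G. G ** M = mat 1) \<longleftrightarrow> rank M = CARD('c)" for M :: "'a::field^'c^'r"
  unfolding matrix_left_invertible_span_rows_gen row_rank_def_gen
  by (metis vec.dim_eq_full vec_dim_card vec.dim_UNIV vec.dimension_def)

lemma rank_less_iff_ker:
  "rank M < CARD('c) \<longleftrightarrow> (\<exists>x. x \<noteq> 0 \<and> M *v x = 0)" for M :: "'a::field^'c^'r"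
proof -
  have "rank M \<le> CARD('c)"
    unfolding row_rank_def_gen by (metis vec.dim_subset[OF subset_UNIV] vec_dim_card)
  then show ?thesis
    using left_inverse_iff_rank[of M] matrix_left_invertible_ker[of M] by auto
qed

lemma full_column_rank_iff: "full_column_rank M \<longleftrightarrow> (\<forall>x. M *v x = 0 \<longrightarrow> x = 0)"
  by (simp add: full_column_rank_def left_inverse_iff_rank[symmetric] matrix_left_invertible_ker)

section \<open>Complex vectors as pairs of real vectors\<close>

text \<open>Keeping the real and imaginary parts as separate real vectors lets a complex eigenvector
  be paired with real quadratic forms.\<close>

definition Cvec :: "real^'n \<Rightarrow> real^'n \<Rightarrow> complex^'n" where
  "Cvec a b = (\<chi> i. Complex (a $ i) (b $ i))"

lemma Cvec_exhaust: obtains a b where "x = Cvec a b"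
proof
  show "x = Cvec (\<chi> i. Re (x $ i)) (\<chi> i. Im (x $ i))"
    by (simp add: Cvec_def vec_eq_iff)
qed

lemma Cvec_eq_iff [simp]: "Cvec a b = Cvec c d \<longleftrightarrow> a = c \<and> b = d"
  by (auto simp: Cvec_def vec_eq_iff)

lemma Cvec_0: "Cvec 0 0 = 0"
  by (simp add: Cvec_def vec_eq_iff complex_eq_iff)

lemma Cvec_eq_0_iff [simp]: "Cvec a b = 0 \<longleftrightarrow> a = 0 \<and> b = 0"
  by (metis Cvec_0 Cvec_eq_iff)

lemma Cvec_add: "Cvec a b + Cvec c d = Cvec (a + c) (b + d)"
  by (simp add: Cvec_def vec_eq_iff complex_eq_iff)

lemma Cvec_scale:
  "z *s Cvec a b = Cvec (Re z *\<^sub>R a - Im z *\<^sub>R b) (Im z *\<^sub>R a + Re z *\<^sub>R b)"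
  by (simp add: Cvec_def vec_eq_iff complex_eq_iff algebra_simps)

lemma Cvec_mult: "map_matrix of_real M *v Cvec a b = Cvec (M *v a) (M *v b)"
  by (simp add: Cvec_def vec_eq_iff complex_eq_iff matrix_vector_mult_def Re_sum Im_sum)

lemma mat_mult_vec: "mat z *v x = z *s x" for x :: "'a::comm_semiring_1^'n"
  by (simp add: vec_eq_iff matrix_vector_mult_def mat_def if_distrib[of "\<lambda>u. u * _"] cong: if_cong)

text \<open>Rank deficiency of the pencil means a nonzero kernel vector; its state part is a + ib,
  its input part is c + id, and the kernel equations are split into real and imaginary
  parts.\<close>

lemma invariant_zero_iff:
  "invariant_zero A B C D z \<longleftrightarrow>
    (\<exists>a b c d. (a \<noteq> 0 \<or> b \<noteq> 0 \<or> c \<noteq> 0 \<or> d \<noteq> 0) \<and>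
      A *v a + B *v c = Re z *\<^sub>R a - Im z *\<^sub>R b \<and>
      A *v b + B *v d = Im z *\<^sub>R a + Re z *\<^sub>R b \<and>
      C *v a + D *v c = 0 \<and> C *v b + D *v d = 0)" (is "_ \<longleftrightarrow> ?R")
proof -
  let ?c = "map_matrix of_real"
  let ?M = "vcat (hcat (?c A - mat z) (?c B)) (hcat (?c C) (?c D))"
  have M: "?M *v x = 0 \<longleftrightarrow> (?c A *v pi1 x + ?c B *v pi2 x = z *s pi1 x \<and> ?c C *v pi1 x + ?c D *v pi2 x = 0)" for x
    by (subst vec_sum_eq_iff)
      (auto simp: hcat_mult matrix_vector_mult_diff_rdistrib mat_mult_vec algebra_simps)
  have "invariant_zero A B C D z \<longleftrightarrow> (\<exists>x. x \<noteq> 0 \<and> ?M *v x = 0)"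
    using rank_less_iff_ker[of ?M] by (simp add: invariant_zero_def)
  also have "\<dots> \<longleftrightarrow> (\<exists>u v. (u \<noteq> 0 \<or> v \<noteq> 0) \<and> ?c A *v u + ?c B *v v = z *s u \<and> ?c C *v u + ?c D *v v = 0)"
  proof safe
    fix x assume "x \<noteq> 0" "?M *v x = 0"
    then show "\<exists>u v. (u \<noteq> 0 \<or> v \<noteq> 0) \<and> ?c A *v u + ?c B *v v = z *s u \<and> ?c C *v u + ?c D *v v = 0"
      unfolding M vec_sum_eq_iff[of x 0] pi_0 by blast
  next
    fix u v assume *: "?c A *v u + ?c B *v v = z *s u" "?c C *v u + ?c D *v v = 0" "u \<noteq> 0"
    then show "\<exists>x. x \<noteq> 0 \<and> ?M *v x = 0"
      by (intro exI[of _ "vpair u v"]) (simp add: M, metis pi_0 pi_vpair)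
  next
    fix u v assume *: "?c A *v u + ?c B *v v = z *s u" "?c C *v u + ?c D *v v = 0" "v \<noteq> 0"
    then show "\<exists>x. x \<noteq> 0 \<and> ?M *v x = 0"
      by (intro exI[of _ "vpair u v"]) (simp add: M, metis pi_0 pi_vpair)
  qed
  also have "\<dots> \<longleftrightarrow> (\<exists>a b c d. (Cvec a b \<noteq> 0 \<or> Cvec c d \<noteq> 0) \<and>
      ?c A *v Cvec a b + ?c B *v Cvec c d = z *s Cvec a b \<and> ?c C *v Cvec a b + ?c D *v Cvec c d = 0)"
    by (metis Cvec_exhaust)
  also have "\<dots> \<longleftrightarrow> ?R"
    by (simp add: Cvec_mult Cvec_add Cvec_scale) blast
  finally show ?thesis .
qed

section \<open>Eigenvectors in invariant subspaces\<close>

text \<open>This is p(M) v, evaluated by Horner's scheme directly on vectors, so that no powers of M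
  have to be formed.\<close>

definition poly_act :: "complex^'n^'n \<Rightarrow> complex poly \<Rightarrow> complex^'n \<Rightarrow> complex^'n" where
  "poly_act M p v = fold_coeffs (\<lambda>a w. a *s v + M *v w) p 0"

lemma poly_act_0 [simp]: "poly_act M 0 v = 0"
  by (simp add: poly_act_def)

lemma poly_act_pCons [simp]: "poly_act M (pCons a p) v = a *s v + M *v poly_act M p v"
  by (cases "p = 0 \<and> a = 0") (auto simp: poly_act_def)

lemma poly_act_add: "poly_act M (p + q) v = poly_act M p v + poly_act M q v"
  by (induction p q rule: poly_induct2)
    (simp_all add: matrix_vector_right_distrib vec.scale_left_distrib)

lemma poly_act_smult: "poly_act M (smult c p) v = c *s poly_act M p v"
  by (induction p) (simp_all add: vec.scale_right_distrib vec.scale matrix_vector_mult_scaleR vector_smult_assoc)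

lemma poly_act_diff: "poly_act M (p - q) v = poly_act M p v - poly_act M q v"
  using poly_act_add[of M "p - q" q v] by simp

lemma poly_act_sum: "poly_act M (\<Sum>i\<in>I. f i) v = (\<Sum>i\<in>I. poly_act M (f i) v)"
  by (induction I rule: infinite_finite_induct) (simp_all add: poly_act_add)

lemma poly_act_linear_factor:
  "poly_act M ([:- z, 1:] * q) v = M *v poly_act M q v - z *s poly_act M q v"
  by (simp add: poly_act_add poly_act_smult poly_act_diff)

lemma poly_act_in_subspace:
  assumes "vec.subspace S" and "\<And>x. x \<in> S \<Longrightarrow> M *v x \<in> S" and "v \<in> S"
  shows "poly_act M p v \<in> S"
  by (induction p) (simp_all add: assms vec.subspace_0 vec.subspace_add vec.subspace_scale)

lemma annihilating_poly_exists: "\<exists>p. p \<noteq> 0 \<and> poly_act M p v = 0"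
proof -
  define w where "w i = poly_act M (monom 1 i) v" for i
  \<comment> \<open>Dependence is a property of sets, so a repetition among the iterates
    \<open>w i\<close> would go unnoticed. It is treated separately and yields a difference of two
    monomials at once.\<close>
  show ?thesis
  proof (cases "inj w")
    case False
    then obtain i j where "w i = w j" "i \<noteq> j"
      by (auto simp: inj_def)
    then show ?thesis
      by (intro exI[of _ "monom 1 i - monom 1 j"]) (simp add: poly_act_diff w_def monom_eq_iff')
  next
    case True
    define n where "n = vec.dim (UNIV :: (complex^'a) set)"
    let ?S = "w ` {..n}"
    have "card ?S = Suc n"
      by (simp add: card_image inj_on_subset[OF True])
    then have "vec.dependent ?S"
      using vec.independent_card_le_dim[of ?S UNIV] n_def by fastforce
    then obtain u where u: "\<exists>x\<in>?S. u x \<noteq> 0" "(\<Sum>x\<in>?S. u x *s x) = 0"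
      using vec.dependent_finite[of ?S] by auto
    define p where "p = (\<Sum>i\<le>n. smult (u (w i)) (monom 1 i))"
    have "coeff p i = u (w i)" if "i \<le> n" for i
      using that by (simp add: p_def coeff_sum if_distrib[of "\<lambda>x. _ * x"] cong: if_cong)
    then have "p \<noteq> 0"
      using u(1) by force
    moreover have "poly_act M p v = (\<Sum>i\<le>n. u (w i) *s w i)"
      by (simp add: p_def poly_act_sum poly_act_smult w_def)
    then have "poly_act M p v = 0"
      using u(2) by (simp add: sum.reindex inj_on_subset[OF True])
    ultimately show ?thesis
      by blast
  qed
qed

text \<open>Take p nonzero with p(M) v = 0 and split off a root, p = (X - z) q. Either q(M) v = 0
  and the degree drops, or q(M) v is an eigenvector for z, which lies in S by invariance.\<close>

lemma eigenvector_in_invariant_subspace: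
  fixes M :: "complex^'n^'n"
  assumes S: "vec.subspace S" "\<And>x. x \<in> S \<Longrightarrow> M *v x \<in> S" and v: "v \<in> S" "v \<noteq> 0"
  obtains x z where "x \<in> S" "x \<noteq> 0" "M *v x = z *s x"
proof -
  have *: "\<exists>x z. x \<in> S \<and> x \<noteq> 0 \<and> M *v x = z *s x" if "p \<noteq> 0" "poly_act M p v = 0" for p
    using that
  proof (induction "degree p" arbitrary: p)
    case 0
    then obtain c where "p = [:c:]"
      by (metis degree_eq_zeroE)
    with 0 v show ?case
      by simp
  next
    case (Suc n)
    obtain z where "poly p z = 0"
      using Suc.hyps(2) fundamental_theorem_of_algebra[of p] constant_degree[of p] by auto
    then obtain q where q: "p = [:- z, 1:] * q"
      using poly_eq_0_iff_dvd by (metis dvdE)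
    show ?case
    proof (cases "poly_act M q v = 0")
      case True
      have "q \<noteq> 0"
        using q Suc.prems by auto
      moreover from this have "degree p = Suc (degree q)"
        unfolding q by (subst degree_mult_eq) auto
      ultimately show ?thesis
        using Suc.hyps True by auto
    next
      case False
      then show ?thesis
        using Suc.prems(2) poly_act_in_subspace[OF S v(1)] unfolding q poly_act_linear_factor
        by (metis eq_iff_diff_eq_0)
    qed
  qed
  show thesis
    using * annihilating_poly_exists that by metis
qed

text \<open>The complexification S + iS is a complex subspace invariant under W, so it contains an
  eigenvector, which is then read off in real and imaginary parts.\<close>

lemma real_invariant_subspace_eigenvector:
  fixes W :: "real^'n^'n"
  assumes S: "subspace S" "\<And>x. x \<in> S \<Longrightarrow> W *v x \<in> S" and v: "v \<in> S" "v \<noteq> 0"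
  obtains a b z where "a \<in> S" "b \<in> S" "a \<noteq> 0 \<or> b \<noteq> 0"
    "W *v a = Re z *\<^sub>R a - Im z *\<^sub>R b" "W *v b = Im z *\<^sub>R a + Re z *\<^sub>R b"
proof -
  let ?T = "{Cvec a b | a b. a \<in> S \<and> b \<in> S}"
  have T: "vec.subspace ?T"
    unfolding vec.subspace_def
  proof (intro conjI ballI allI)
    show "0 \<in> ?T"
      using Cvec_0 subspace_0[OF S(1)] by force
    show "x + y \<in> ?T" if "x \<in> ?T" "y \<in> ?T" for x y
      using that by (auto simp: Cvec_add intro!: subspace_add S)
    show "c *s x \<in> ?T" if "x \<in> ?T" for x c
      using that by (auto simp: Cvec_scale intro!: subspace_add subspace_diff subspace_mul S)
  qed
  have inv: "map_matrix of_real W *v x \<in> ?T" if "x \<in> ?T" for x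
    using that S(2) by (auto simp: Cvec_mult)
  have "Cvec v v \<in> ?T" "Cvec v v \<noteq> 0"
    using v by auto
  from eigenvector_in_invariant_subspace[OF T inv this]
  obtain x z where x: "x \<in> ?T" "x \<noteq> 0" "map_matrix of_real W *v x = z *s x" .
  then obtain a b where "x = Cvec a b" "a \<in> S" "b \<in> S"
    by blast
  with x show thesis
    by (intro that[of a b z]) (auto simp: Cvec_mult Cvec_scale)
qed

section \<open>Quadratic forms\<close>

lemma inner_transpose_mult: "x \<bullet> (transpose M *v y) = (M *v x) \<bullet> y" for M :: "real^'n^'m"
  by (metis dot_lmul_matrix transpose_matrix_vector transpose_transpose inner_commute)

lemma inner_symmetric_mult:
  "transpose M = M \<Longrightarrow> x \<bullet> (M *v y) = (M *v x) \<bullet> y" for M :: "real^'n^'n"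
  by (metis inner_transpose_mult)

lemma inner_He: "x \<bullet> (He M *v x) = 2 * (x \<bullet> (M *v x))"
  by (simp add: He_def matrix_vector_mult_add_rdistrib inner_add_right inner_transpose_mult
      inner_commute del: transpose_matrix_vector)

lemma matrix_mult_scaleR: "A ** (k *\<^sub>R B) = k *\<^sub>R (A ** B)"
  for A :: "real^'m^'n" and B :: "real^'l^'m"
  by (simp add: matrix_scalar_ac scalar_matrix_assoc)

lemma transpose_add: "transpose (M + N) = transpose M + transpose N"
  by (simp add: transpose_def vec_eq_iff)

lemma transpose_He: "transpose (He M) = He M"
  by (simp add: He_def transpose_add add.commute)

lemma He_pd_iff: "He M \<in> pd \<longleftrightarrow> (\<forall>x. x \<noteq> 0 \<longrightarrow> x \<bullet> (M *v x) > 0)"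
  by (simp add: pd_def transpose_He inner_He)

text \<open>Moving from x in direction w = M x changes the form by 2 t |w|^2 plus a term quadratic
  in t. For small negative t this would be negative unless w = 0.\<close>

lemma psd_kernel:
  assumes M: "M \<in> psd" and x: "x \<bullet> (M *v x) = 0"
  shows "M *v x = 0"
proof -
  have sym: "transpose M = M" and nn: "y \<bullet> (M *v y) \<ge> 0" for y
    using M by (auto simp: psd_def)
  define w where "w = M *v x"
  have *: "0 \<le> t * (2 * (w \<bullet> w) + t * (w \<bullet> (M *v w)))" for t
  proof -
    have "x \<bullet> (M *v w) = w \<bullet> w"
      by (simp add: inner_symmetric_mult[OF sym] w_def)
    then have "(x + t *\<^sub>R w) \<bullet> (M *v (x + t *\<^sub>R w)) = t * (2 * (w \<bullet> w) + t * (w \<bullet> (M *v w)))"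
      using x by (simp add: matrix_vector_right_distrib matrix_vector_mult_scaleR inner_add_left inner_add_right
          w_def[symmetric] algebra_simps)
    then show ?thesis
      using nn by metis
  qed
  have "w \<bullet> w \<le> 0"
  proof (rule ccontr)
    assume "\<not> ?thesis"
    then have pos: "w \<bullet> w > 0"
      by linarith
    \<comment> \<open>The added 1 keeps the denominator positive, and this t bounds the quadratic
      contribution by half of the linear one.\<close>
    define t where "t = - (w \<bullet> w) / (w \<bullet> (M *v w) + 1)"
    have "t < 0"
      using pos nn[of w] by (simp add: t_def divide_neg_pos)
    moreover have "2 * (w \<bullet> w) + t * (w \<bullet> (M *v w)) > 0"
    proof -
      have "- t * (w \<bullet> (M *v w)) \<le> - t * (w \<bullet> (M *v w) + 1)"
        using \<open>t < 0\<close> by simp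
      also have "\<dots> = w \<bullet> w"
        using nn[of w] by (simp add: t_def)
      finally show ?thesis
        using pos by linarith
    qed
    ultimately show False
      using *[of t] by (meson mult_neg_pos not_le)
  qed
  then show ?thesis
    unfolding w_def by (meson inner_ge_zero inner_eq_zero_iff order_antisym)
qed

lemma pd_left_inverse: "M \<in> pd \<Longrightarrow> \<exists>N. N ** M = mat 1"
  unfolding matrix_left_invertible_ker pd_def by force

lemma pd_scale: "M \<in> pd \<Longrightarrow> c > 0 \<Longrightarrow> c *\<^sub>R M \<in> pd"
  by (simp add: pd_def transpose_scalar scaleR_matrix_vector_assoc[symmetric])

lemma pd_trace_pos: "M \<in> pd \<Longrightarrow> trace M > 0"
proof -
  assume M: "M \<in> pd"
  have "M $ i $ i > 0" for i
  proof -
    have "axis i 1 \<bullet> (M *v axis i 1) > 0"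
      using M by (simp add: pd_def axis_eq_0_iff)
    then show ?thesis
      by (simp add: inner_axis' matrix_vector_mult_basis column_def)
  qed
  then show ?thesis
    by (simp add: trace_def sum_pos)
qed

lemma mdot_mat_1: "mdot (mat 1) M = trace M"
  by (simp add: mdot_def trace_def transpose_def)

section \<open>Strong feasibility as an unnormalized inequality\<close>

lemma inner_dual_block:
  "x \<bullet> (dual_block Z11 Z21 Z22 Z31 Z32 Z33 *v x) =
    pi1 x \<bullet> (Z11 *v pi1 x) + 2 * (pi1 (pi2 x) \<bullet> (Z21 *v pi1 x)) + pi1 (pi2 x) \<bullet> (Z22 *v pi1 (pi2 x))
    + 2 * (pi2 (pi2 x) \<bullet> (Z31 *v pi1 x)) + 2 * (pi2 (pi2 x) \<bullet> (Z32 *v pi1 (pi2 x)))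
    + pi2 (pi2 x) \<bullet> (Z33 *v pi2 (pi2 x))"
  unfolding dual_block_def
  by (simp add: inner_vec_sum hcat_mult inner_add_right inner_transpose_mult inner_commute
      del: transpose_matrix_vector)

lemma transpose_dual_block:
  "transpose (dual_block Z11 Z21 Z22 Z31 Z32 Z33) = dual_block Z11 Z21 Z22 Z31 Z32 Z33 \<longleftrightarrow>
    transpose Z11 = Z11 \<and> transpose Z22 = Z22 \<and> transpose Z33 = Z33"
  by (auto simp: dual_block_def transpose_def vcat_def hcat_def vec_eq_iff split_sum_all)

text \<open>Restricting the block form to its first component gives \<open>X \<in> pd\<close>.
  Conversely, X and Y extend to a positive definite block matrix if the (2,2) block is large enough;
  the trace constraint is then met by scaling, since the other conditions are homogeneous.\<close>

lemma dual_strongly_feasible_iff: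
  fixes A :: "real^'n^'n" and B1 :: "real^'m1^'n" and B2 :: "real^'m2^'n"
    and C1 :: "real^'n^'p1" and D11 :: "real^'m1^'p1" and D12 :: "real^'m2^'p1"
  shows "dual_strongly_feasible A B1 B2 C1 D11 D12 \<longleftrightarrow>
    (\<exists>X Y. X \<in> pd \<and> transpose B2 ** X + transpose D12 ** Y = 0 \<and> dual_lyap A C1 X Y \<in> pd)"
proof
  assume "dual_strongly_feasible A B1 B2 C1 D11 D12"
  then obtain X Y Z22 Z31 Z32 and Z33 :: "real^'m1^'m1" where
    eq: "transpose B2 ** X + transpose D12 ** Y = 0" "dual_lyap A C1 X Y \<in> pd"
    and bl: "dual_block X Y Z22 Z31 Z32 Z33 \<in> pd"
    unfolding dual_strongly_feasible_def dual_equalities_def by blast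
  have "X \<in> pd"
    unfolding pd_def
  proof (safe)
    show "transpose X = X"
      using bl by (simp add: pd_def transpose_dual_block)
    fix x :: "real^'n" assume "x \<noteq> 0"
    then have "vpair x (0 :: real^('p1 + 'm1)) \<noteq> 0"
      by (metis pi_0(1) pi_vpair(1))
    then have "vpair x 0 \<bullet> (dual_block X Y Z22 Z31 Z32 Z33 *v vpair x 0) > 0"
      using bl by (simp add: pd_def)
    then show "x \<bullet> (X *v x) > 0"
      by (simp add: inner_dual_block)
  qed
  with eq show "\<exists>X Y. X \<in> pd \<and> transpose B2 ** X + transpose D12 ** Y = 0 \<and> dual_lyap A C1 X Y \<in> pd"
    by blast
next
  assume "\<exists>X Y. X \<in> pd \<and> transpose B2 ** X + transpose D12 ** Y = 0 \<and> dual_lyap A C1 X Y \<in> pd"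
  then obtain X Y where X: "X \<in> pd" and eq: "transpose B2 ** X + transpose D12 ** Y = 0"
    and ly: "dual_lyap A C1 X Y \<in> pd"
    by blast
  have sX: "transpose X = X"
    using X by (simp add: pd_def)
  obtain X' where "X' ** X = mat 1"
    using pd_left_inverse[OF X] by blast
  define K where "K = Y ** X'"
  have Y: "Y = K ** X"
    by (simp add: K_def matrix_mul_assoc[symmetric] \<open>X' ** X = mat 1\<close>)
  \<comment> \<open>\<open>K ** X ** transpose K\<close> is \<open>Y X\<inverse> Y\<^sup>T\<close>, so that the Schur complement of \<open>X\<close> is the identity.\<close>
  define V where "V = K ** X ** transpose K + mat 1"
  let ?I = "mat 1 :: real^'m1^'m1"
  have sV: "transpose V = V"
    by (simp add: V_def transpose_add matrix_transpose_mul sX matrix_mul_assoc)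
  have bl: "x \<bullet> (dual_block X Y V 0 0 ?I *v x) > 0" if "x \<noteq> 0" for x
  proof -
    define u v w where uvw: "u = pi1 x" "v = pi1 (pi2 x)" "w = pi2 (pi2 x)"
    \<comment> \<open>Completing the square: s absorbs the cross term between u and v.\<close>
    define s where "s = u + transpose K *v v"
    have Q: "x \<bullet> (dual_block X Y V 0 0 ?I *v x) = s \<bullet> (X *v s) + v \<bullet> v + w \<bullet> w"
    proof -
      have "v \<bullet> (V *v v) = (transpose K *v v) \<bullet> (X *v (transpose K *v v)) + v \<bullet> v"
        by (simp add: V_def matrix_vector_mult_add_rdistrib inner_add_right matrix_vector_mul_assoc[symmetric]
            dot_lmul_matrix)
      moreover have "v \<bullet> (Y *v u) = (transpose K *v v) \<bullet> (X *v u)"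
        by (simp add: Y matrix_vector_mul_assoc[symmetric] dot_lmul_matrix)
      moreover have "u \<bullet> (X *v (transpose K *v v)) = (transpose K *v v) \<bullet> (X *v u)"
        using inner_symmetric_mult[OF sX] by (metis inner_commute)
      ultimately show ?thesis
        by (simp add: inner_dual_block uvw[symmetric] s_def matrix_vector_right_distrib inner_add_left inner_add_right
            del: transpose_matrix_vector)
    qed
    have "s \<bullet> (X *v s) \<ge> 0" "s \<noteq> 0 \<Longrightarrow> s \<bullet> (X *v s) > 0"
      using X by (cases "s = 0"; force simp: pd_def)+
    moreover have "v \<noteq> 0 \<or> w \<noteq> 0 \<or> s \<noteq> 0"
    proof (rule ccontr)
      assume "\<not> ?thesis"
      then have "u = 0" "v = 0" "w = 0"
        by (auto simp: s_def)
      then have "x = 0"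
        unfolding uvw by (simp add: vec_sum_eq_iff[of x 0] vec_sum_eq_iff[of "pi2 x" 0])
      with that show False ..
    qed
    ultimately show ?thesis
      unfolding Q by (metis add_nonneg_pos add_pos_nonneg inner_ge_zero inner_gt_zero_iff add_nonneg_nonneg)
  qed
  have Vpd: "V \<in> pd"
    unfolding pd_def
  proof (safe)
    show "transpose V = V" by (rule sV)
    fix v :: "real^'p1" assume "v \<noteq> 0"
    then have "vpair (0 :: real^'n) (vpair v (0 :: real^'m1)) \<noteq> 0"
      by (metis pi_0 pi_vpair)
    from bl[OF this] show "v \<bullet> (V *v v) > 0"
      by (simp add: inner_dual_block)
  qed
  define c where "c = 1 / (trace V + trace ?I)"
  have "trace ?I > 0"
    by (simp add: trace_I)
  then have c: "c > 0" "c * trace V + c * trace ?I = 1"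
    using pd_trace_pos[OF Vpd] by (simp_all add: c_def add_divide_distrib[symmetric])
  have "dual_equalities B2 D12 (c *\<^sub>R X) (c *\<^sub>R Y) (c *\<^sub>R V) (c *\<^sub>R ?I)"
    using c(2) eq unfolding dual_equalities_def mdot_mat_1 matrix_mult_scaleR scaleR_add_right[symmetric]
    by (simp add: trace_def sum_distrib_left)
  moreover have "dual_lyap A C1 (c *\<^sub>R X) (c *\<^sub>R Y) = c *\<^sub>R dual_lyap A C1 X Y"
    by (simp add: dual_lyap_def He_def matrix_mult_scaleR transpose_add transpose_scalar scaleR_add_right)
  moreover have "dual_block (c *\<^sub>R X) (c *\<^sub>R Y) (c *\<^sub>R V) 0 0 (c *\<^sub>R ?I) = c *\<^sub>R dual_block X Y V 0 0 ?I"
    by (simp add: dual_block_def vcat_def hcat_def transpose_def vec_eq_iff split_sum_all)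
  moreover have "dual_block X Y V 0 0 ?I \<in> pd"
    using bl sX sV by (simp add: pd_def transpose_dual_block)
  ultimately show "dual_strongly_feasible A B1 B2 C1 D11 D12"
    unfolding dual_strongly_feasible_def using pd_scale c(1) ly by metis
qed

section \<open>Obstructions to strong feasibility\<close>

text \<open>For v in the kernel of D, pairing the equality constraint with v leaves X (B v) = 0.
  Since X is invertible, B v = 0, so v lies in the kernel of the stacked matrix.\<close>

lemma feasible_imp_full_column_rank:
  assumes full: "full_column_rank (vcat B D)"
    and X: "X \<in> pd" and eq: "transpose B ** X + transpose D ** Y = 0"
  shows "full_column_rank D"
  unfolding full_column_rank_iff
proof (intro allI impI)
  fix v assume Dv: "D *v v = 0"
  have "X *v (B *v v) = 0"
  proof -
    have "(X *v (B *v v)) \<bullet> w = (B *v v) \<bullet> (X *v w)" for w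
      using X inner_symmetric_mult by (metis (mono_tags, lifting) pd_def mem_Collect_eq)
    also have "(B *v v) \<bullet> (X *v w) = v \<bullet> ((transpose B ** X + transpose D ** Y) *v w)" for w
      using Dv
      by (simp add: matrix_vector_mult_add_rdistrib inner_add_right matrix_vector_mul_assoc[symmetric]
          inner_transpose_mult del: transpose_matrix_vector)
    finally have "(X *v (B *v v)) \<bullet> w = 0" for w
      by (simp add: eq)
    then show ?thesis
      by (metis inner_eq_zero_iff)
  qed
  then have "B *v v = 0"
    using pd_left_inverse[OF X] matrix_left_invertible_ker by blast
  with Dv have "vcat B D *v v = 0"
    by (simp add: vec_sum_eq_iff[of _ 0])
  then show "v = 0"
    using full full_column_rank_iff by blast
qed

lemma feasible_imp_Re_pos:
  assumes full: "full_column_rank (vcat B D)"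
    and X: "X \<in> pd" and eq: "transpose B ** X + transpose D ** Y = 0"
    and ly: "dual_lyap A C X Y \<in> pd" and z: "invariant_zero A B C D z"
  shows "Re z > 0"
proof -
  obtain a b c d where nz: "a \<noteq> 0 \<or> b \<noteq> 0 \<or> c \<noteq> 0 \<or> d \<noteq> 0"
    and ab: "A *v a + B *v c = Re z *\<^sub>R a - Im z *\<^sub>R b" "A *v b + B *v d = Im z *\<^sub>R a + Re z *\<^sub>R b"
    and cd: "C *v a + D *v c = 0" "C *v b + D *v d = 0"
    using z unfolding invariant_zero_iff by blast
  have sX: "transpose X = X"
    using X by (simp add: pd_def)
  \<comment> \<open>With zero state part, the input parts c and d would lie in the kernel of the
    stacked matrix.\<close>
  have ab_nz: "a \<noteq> 0 \<or> b \<noteq> 0"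
  proof (rule ccontr)
    assume "\<not> ?thesis"
    with ab cd have "vcat B D *v c = 0" "vcat B D *v d = 0"
      by (simp_all add: vec_sum_eq_iff[of _ 0])
    then show False
      using full nz \<open>\<not> _\<close> full_column_rank_iff by metis
  qed
  have Bv: "(B *v v) \<bullet> (X *v x) + (D *v v) \<bullet> (Y *v x) = 0" for v x
  proof -
    have "v \<bullet> ((transpose B ** X + transpose D ** Y) *v x) = 0"
      by (simp add: eq)
    then show ?thesis
      by (simp add: matrix_vector_mult_add_rdistrib inner_add_right matrix_vector_mul_assoc[symmetric]
          inner_transpose_mult del: transpose_matrix_vector)
  qed
  \<comment> \<open>On a pair (x, v) with zero output, the equality constraint trades the term in Y
    for B v paired with X x.\<close>
  have L: "x \<bullet> ((transpose A ** X + transpose C ** Y) *v x) = (A *v x + B *v v) \<bullet> (X *v x)"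
    if "C *v x + D *v v = 0" for x v
  proof -
    have "C *v x = - (D *v v)"
      using that by (simp add: eq_neg_iff_add_eq_0)
    then show ?thesis
      using Bv[of v x]
      by (simp add: matrix_vector_mult_add_rdistrib inner_add_right inner_add_left matrix_vector_mul_assoc[symmetric]
          inner_transpose_mult del: transpose_matrix_vector)
  qed
  have "x \<bullet> ((transpose A ** X + transpose C ** Y) *v x) \<ge> 0"
    "x \<noteq> 0 \<Longrightarrow> x \<bullet> ((transpose A ** X + transpose C ** Y) *v x) > 0" for x
    using ly unfolding dual_lyap_def He_pd_iff by (cases "x = 0"; force)+
  then have "0 < a \<bullet> ((transpose A ** X + transpose C ** Y) *v a) + b \<bullet> ((transpose A ** X + transpose C ** Y) *v b)"
    using ab_nz by (metis add_nonneg_pos add_pos_nonneg)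
  also have "\<dots> = (Re z *\<^sub>R a - Im z *\<^sub>R b) \<bullet> (X *v a) + (Im z *\<^sub>R a + Re z *\<^sub>R b) \<bullet> (X *v b)"
    by (simp only: L[OF cd(1)] L[OF cd(2)] ab)
  \<comment> \<open>The terms with Im z cancel because X is symmetric.\<close>
  also have "\<dots> = Re z * (a \<bullet> (X *v a) + b \<bullet> (X *v b))"
    using inner_symmetric_mult[OF sX, of a b]
    by (simp add: inner_diff_left inner_add_left algebra_simps inner_commute)
  finally have "0 < Re z * (a \<bullet> (X *v a) + b \<bullet> (X *v b))" .
  moreover have "a \<bullet> (X *v a) + b \<bullet> (X *v b) \<ge> 0"
    using X by (cases "a = 0"; cases "b = 0"; simp add: pd_def add_nonneg_nonneg less_imp_le)
  ultimately show ?thesis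
    by (auto simp: zero_less_mult_iff)
qed

section \<open>A certificate of infeasibility\<close>

definition outer :: "real^'n \<Rightarrow> real^'m \<Rightarrow> real^'m^'n" where
  "outer x y = (\<chi> i j. x $ i * y $ j)"

lemma inner_outer: "P \<bullet> outer x y = x \<bullet> (P *v y)"
  by (simp add: outer_def inner_vec_def matrix_vector_mult_def sum_distrib_left algebra_simps)

lemma matrix_mult_outer: "M ** outer x y = outer (M *v x) y"
  by (simp add: outer_def matrix_matrix_mult_def matrix_vector_mult_def vec_eq_iff sum_distrib_right mult.assoc)

lemma outer_mult_vec: "outer x y *v z = (y \<bullet> z) *\<^sub>R x"
  by (simp add: outer_def matrix_vector_mult_def vec_eq_iff inner_vec_def sum_distrib_right sum_distrib_left mult_ac)

lemma transpose_outer: "transpose (outer x y) = outer y x"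
  by (simp add: outer_def transpose_def vec_eq_iff mult.commute)

lemma inner_transpose_matrix_mult: "P \<bullet> (transpose E ** Z) = (E ** P) \<bullet> Z"
  for P :: "real^'k^'n" and E :: "real^'n^'p" and Z :: "real^'k^'p"
proof -
  have "P \<bullet> (transpose E ** Z) = (\<Sum>i\<in>UNIV. \<Sum>j\<in>UNIV. \<Sum>l\<in>UNIV. P $ i $ j * E $ l $ i * Z $ l $ j)"
    by (simp add: inner_vec_def matrix_matrix_mult_def transpose_def sum_distrib_left mult_ac)
  also have "\<dots> = (\<Sum>i\<in>UNIV. \<Sum>l\<in>UNIV. \<Sum>j\<in>UNIV. P $ i $ j * E $ l $ i * Z $ l $ j)"
    by (rule sum.cong[OF refl], rule sum.swap)
  also have "\<dots> = (\<Sum>l\<in>UNIV. \<Sum>i\<in>UNIV. \<Sum>j\<in>UNIV. P $ i $ j * E $ l $ i * Z $ l $ j)"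
    by (rule sum.swap)
  also have "\<dots> = (\<Sum>l\<in>UNIV. \<Sum>j\<in>UNIV. \<Sum>i\<in>UNIV. P $ i $ j * E $ l $ i * Z $ l $ j)"
    by (rule sum.cong[OF refl], rule sum.swap)
  also have "\<dots> = (E ** P) \<bullet> Z"
    by (simp add: inner_vec_def matrix_matrix_mult_def sum_distrib_right sum_distrib_left mult_ac)
  finally show ?thesis .
qed

lemma inner_transpose_transpose: "transpose P \<bullet> transpose Q = P \<bullet> Q" for P :: "real^'m^'n"
  by (simp add: inner_vec_def transpose_def) (rule sum.swap)

text \<open>The skew part K = P - P^T is itself a test matrix, and K paired with itself is twice P
  paired with K.\<close>

lemma symmetric_if_orthogonal_skew:
  fixes P :: "real^'n^'n"
  assumes "\<And>K. (\<And>x. x \<bullet> (K *v x) = 0) \<Longrightarrow> P \<bullet> K = 0"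
  shows "transpose P = P"
proof -
  let ?K = "P - transpose P"
  have "x \<bullet> (?K *v x) = 0" for x
    by (simp add: matrix_vector_mult_diff_rdistrib inner_diff_right inner_transpose_mult inner_commute
        del: transpose_matrix_vector)
  then have "P \<bullet> ?K = 0"
    by (rule assms)
  moreover have "transpose P \<bullet> transpose P = P \<bullet> P"
    by (rule inner_transpose_transpose)
  ultimately have "?K \<bullet> ?K = 0"
    by (simp add: inner_diff_left inner_diff_right inner_commute)
  then show ?thesis
    by simp
qed

text \<open>Letting e tend to 0 carries inequalities from strictly positive matrices over to
  rank-one matrices on the boundary of the cone.\<close>

lemma nonneg_if_small_perturbation:
  fixes c k :: real
  assumes "\<And>e. e > 0 \<Longrightarrow> 0 \<le> e * k + c"
  shows "0 \<le> c"
proof (rule ccontr)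
  assume "\<not> 0 \<le> c"
  define e where "e = - c / (2 * (\<bar>k\<bar> + 1))"
  have "e > 0"
    using \<open>\<not> 0 \<le> c\<close> by (simp add: e_def divide_neg_pos)
  have "e * k \<le> e * (\<bar>k\<bar> + 1)"
    using \<open>e > 0\<close> by (intro mult_left_mono) auto
  also have "\<dots> = - c / 2"
    by (simp add: e_def field_simps)
  finally show False
    using assms[OF \<open>e > 0\<close>] \<open>\<not> 0 \<le> c\<close> by linarith
qed

text \<open>Infeasibility makes the subspace of pairs (X, W^T X + E^T Z) miss the cone of pairs of
  positive forms. A separating functional (P, Q) vanishes on the subspace and is nonnegative on the
  cone; the cone makes P and Q semidefinite, and the subspace relates Q to W and E.\<close>

lemma lyapunov_alternative:
  fixes W :: "real^'n^'n" and E :: "real^'n^'p"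
  assumes infeasible: "\<nexists>X Z. X \<in> pd \<and> He (transpose W ** X + transpose E ** Z) \<in> pd"
  obtains Q where "Q \<in> psd" "Q \<noteq> 0" "E ** Q = 0" "\<And>y. y \<bullet> (W *v (Q *v y)) \<le> 0"
proof -
  \<comment> \<open>Both sets constrain only the quadratic forms of their members, hence are invariant under adding
    skew matrices; this forces the separating functional to be symmetric.\<close>
  define S where "S = {(M, N) | M N. \<exists>X Z. transpose X = X \<and> (\<forall>x. x \<bullet> (M *v x) = x \<bullet> (X *v x)) \<and>
      (\<forall>x. x \<bullet> (N *v x) = x \<bullet> ((transpose W ** X + transpose E ** Z) *v x))}"
  define T :: "((real^'n^'n) \<times> (real^'n^'n)) set" where
    "T = {(M, N) | M N. \<forall>x. x \<noteq> 0 \<longrightarrow> 0 < x \<bullet> (M *v x) \<and> 0 < x \<bullet> (N *v x)}"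
  have S_I: "(M, N) \<in> S" if "transpose X = X" "\<And>x. x \<bullet> (M *v x) = x \<bullet> (X *v x)"
    "\<And>x. x \<bullet> (N *v x) = x \<bullet> ((transpose W ** X + transpose E ** Z) *v x)" for M N X Z
    using that unfolding S_def by blast
  have "subspace S"
    unfolding subspace_def
  proof (intro conjI ballI allI)
    have "(0, 0) \<in> S"
      by (rule S_I[of 0 _ _ 0]) (simp_all add: transpose_def vec_eq_iff)
    then show "0 \<in> S"
      by (simp add: zero_prod_def)
  next
    fix s t assume "s \<in> S" "t \<in> S"
    then obtain M N X Z M' N' X' Z' where st: "s = (M, N)" "t = (M', N')" "transpose X = X" "transpose X' = X'"
      and "\<And>x. x \<bullet> (M *v x) = x \<bullet> (X *v x)" "\<And>x. x \<bullet> (M' *v x) = x \<bullet> (X' *v x)"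
      "\<And>x. x \<bullet> (N *v x) = x \<bullet> ((transpose W ** X + transpose E ** Z) *v x)"
      "\<And>x. x \<bullet> (N' *v x) = x \<bullet> ((transpose W ** X' + transpose E ** Z') *v x)"
      unfolding S_def by blast
    then have "(M + M', N + N') \<in> S"
      by (intro S_I[of "X + X'" _ _ "Z + Z'"])
        (simp_all add: transpose_add matrix_add_ldistrib matrix_vector_mult_add_rdistrib inner_add_right)
    then show "s + t \<in> S"
      by (simp add: st)
  next
    fix k s assume "s \<in> S"
    then obtain M N X Z where s: "s = (M, N)" "transpose X = X"
      and "\<And>x. x \<bullet> (M *v x) = x \<bullet> (X *v x)"
      "\<And>x. x \<bullet> (N *v x) = x \<bullet> ((transpose W ** X + transpose E ** Z) *v x)"
      unfolding S_def by blast
    then have "(k *\<^sub>R M, k *\<^sub>R N) \<in> S"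
      by (intro S_I[of "k *\<^sub>R X" _ _ "k *\<^sub>R Z"])
        (simp_all add: transpose_scalar matrix_mult_scaleR matrix_vector_mult_add_rdistrib inner_add_right
          scaleR_matrix_vector_assoc[symmetric] distrib_left)
    then show "k *\<^sub>R s \<in> S"
      by (simp add: s)
  qed
  have "convex T"
    unfolding convex_def
  proof (intro ballI allI impI)
    fix s t and u v :: real assume st: "s \<in> T" "t \<in> T" and uv: "0 \<le> u" "0 \<le> v" "u + v = 1"
    have pos: "0 < u * a + v * b" if "0 < a" "0 < b" for a b :: real
    proof (cases "u = 0")
      case False
      then show ?thesis
        using uv that by (intro add_pos_nonneg) auto
    qed (use uv that in simp)
    obtain M N M' N' where "s = (M, N)" "t = (M', N')"
      by (metis surj_pair)
    with st show "u *\<^sub>R s + v *\<^sub>R t \<in> T"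
      by (simp add: T_def matrix_vector_mult_add_rdistrib inner_add_right scaleR_matrix_vector_assoc[symmetric] pos)
  qed
  have TI: "(mat 1, mat 1) \<in> T"
    by (simp add: T_def)
  have "S \<inter> T = {}"
  proof (safe)
    fix M N assume "(M, N) \<in> S" "(M, N) \<in> T"
    then obtain X Z where "transpose X = X" "\<And>x. x \<bullet> (M *v x) = x \<bullet> (X *v x)"
      "\<And>x. x \<bullet> (N *v x) = x \<bullet> ((transpose W ** X + transpose E ** Z) *v x)"
      and "\<And>x. x \<noteq> 0 \<Longrightarrow> 0 < x \<bullet> (M *v x) \<and> 0 < x \<bullet> (N *v x)"
      unfolding S_def T_def by blast
    then have "X \<in> pd" "He (transpose W ** X + transpose E ** Z) \<in> pd"
      unfolding He_pd_iff by (simp_all add: pd_def)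
    with infeasible show "(M, N) \<in> {}"
      by blast
  qed
  moreover have "S \<noteq> {}"
    using subspace_0[OF \<open>subspace S\<close>] by blast
  ultimately obtain a b where "a \<noteq> 0" and a: "\<And>s. s \<in> S \<Longrightarrow> a \<bullet> s \<le> b" "\<And>t. t \<in> T \<Longrightarrow> a \<bullet> t \<ge> b"
    using separating_hyperplane_sets[of S T] subspace_imp_convex[OF \<open>subspace S\<close>] \<open>convex T\<close> TI by blast
  obtain P Q where PQ: "a = (P, Q)"
    by (metis surj_pair)
  have "b \<ge> 0"
    using a(1)[OF subspace_0[OF \<open>subspace S\<close>]] by simp
  \<comment> \<open>A linear functional bounded above on a subspace vanishes there: were its value r
    nonzero, scaling by (b + 1) / r would exceed the bound b.\<close>
  have S0: "P \<bullet> M + Q \<bullet> N = 0" if "(M, N) \<in> S" for M N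
  proof -
    let ?r = "P \<bullet> M + Q \<bullet> N"
    have "k * ?r \<le> b" for k
      using a(1)[OF subspace_mul[OF \<open>subspace S\<close> that, of k]] by (simp add: PQ distrib_left)
    from this[of "(b + 1) / ?r"] show ?thesis
      by (cases "?r = 0") auto
  qed
  have T0: "P \<bullet> M + Q \<bullet> N \<ge> 0" if "(M, N) \<in> T" for M N
    using a(2)[OF that] \<open>b \<ge> 0\<close> by (simp add: PQ)
  have "transpose P = P"
  proof (rule symmetric_if_orthogonal_skew)
    fix K :: "real^'n^'n" assume "\<And>x. x \<bullet> (K *v x) = 0"
    then have "(K, 0) \<in> S"
      by (intro S_I[of 0 _ _ 0]) (simp_all add: transpose_def vec_eq_iff)
    from S0[OF this] show "P \<bullet> K = 0" by simp
  qed
  have "transpose Q = Q"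
  proof (rule symmetric_if_orthogonal_skew)
    fix K :: "real^'n^'n" assume "\<And>x. x \<bullet> (K *v x) = 0"
    then have "(0, K) \<in> S"
      by (intro S_I[of 0 _ _ 0]) (simp_all add: transpose_def vec_eq_iff)
    from S0[OF this] show "Q \<bullet> K = 0" by simp
  qed
  have outer_nonneg: "0 \<le> x \<bullet> (outer y y *v x)" for x y :: "real^'n"
    by (simp add: outer_mult_vec inner_commute)
  \<comment> \<open>The pair of \<open>outer y y\<close> and 0 is only on the boundary of
    \<open>T\<close>; adding e times the identity to both components moves it inside.\<close>
  have "y \<bullet> (P *v y) \<ge> 0" for y
  proof (rule nonneg_if_small_perturbation)
    fix e :: real assume "e > 0"
    then have "(e *\<^sub>R mat 1 + outer y y, e *\<^sub>R mat 1) \<in> T"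
      by (simp add: T_def matrix_vector_mult_add_rdistrib inner_add_right scaleR_matrix_vector_assoc[symmetric]
          outer_nonneg add_pos_nonneg)
    from T0[OF this] show "0 \<le> e * (P \<bullet> mat 1 + Q \<bullet> mat 1) + y \<bullet> (P *v y)"
      by (simp add: inner_add_right inner_outer distrib_left)
  qed
  with \<open>transpose P = P\<close> have P: "P \<in> psd"
    by (simp add: psd_def)
  have "y \<bullet> (Q *v y) \<ge> 0" for y
  proof (rule nonneg_if_small_perturbation)
    fix e :: real assume "e > 0"
    then have "(e *\<^sub>R mat 1, e *\<^sub>R mat 1 + outer y y) \<in> T"
      by (simp add: T_def matrix_vector_mult_add_rdistrib inner_add_right scaleR_matrix_vector_assoc[symmetric]
          outer_nonneg add_pos_nonneg)
    from T0[OF this] show "0 \<le> e * (P \<bullet> mat 1 + Q \<bullet> mat 1) + y \<bullet> (Q *v y)"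
      by (simp add: inner_add_right inner_outer distrib_left)
  qed
  with \<open>transpose Q = Q\<close> have Q: "Q \<in> psd"
    by (simp add: psd_def)
  \<comment> \<open>Testing with X = y y^T and Z = 0 identifies P with minus the symmetric part of W
    Q.\<close>
  have WQ: "y \<bullet> (P *v y) + y \<bullet> (W *v (Q *v y)) = 0" for y
  proof -
    have "(outer y y, transpose W ** outer y y) \<in> S"
      by (intro S_I[of "outer y y" _ _ 0]) (simp_all add: transpose_outer)
    from S0[OF this] have "y \<bullet> (P *v y) + (transpose W *v y) \<bullet> (Q *v y) = 0"
      by (simp add: matrix_mult_outer inner_outer del: transpose_matrix_vector)
    then show ?thesis
      by (simp add: dot_lmul_matrix)
  qed
  \<comment> \<open>With X = 0 and Z = E Q the functional takes the value |E Q|^2, which must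
    vanish.\<close>
  have "(0, transpose E ** (E ** Q)) \<in> S"
    by (intro S_I[of 0 _ _ "E ** Q"]) (simp_all add: transpose_def vec_eq_iff)
  then have "E ** Q = 0"
    using S0[of 0 "transpose E ** (E ** Q)"] by (simp add: inner_transpose_matrix_mult)
  moreover have "Q \<noteq> 0"
  proof
    assume "Q = 0"
    then have "P *v y = 0" for y
      using psd_kernel[OF P] WQ by simp
    then have "P = 0"
      by (simp add: matrix_eq)
    with \<open>Q = 0\<close> \<open>a \<noteq> 0\<close> PQ show False
      by (simp add: zero_prod_def)
  qed
  moreover have "y \<bullet> (W *v (Q *v y)) \<le> 0" for y
    using P WQ[of y] by (simp add: psd_def) (metis add.commute add_nonneg_eq_0_iff linorder_le_cases order_refl)
  ultimately show thesis
    using that Q by blast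
qed

section \<open>From a certificate to an invariant zero\<close>

text \<open>The sign condition forces W Q w to be orthogonal to the kernel of Q, hence to lie in its
  range, which is therefore invariant under W. For an eigenvector with parts a = Q c and b = Q d,
  adding the condition at c and at d gives Re z times a positive number.\<close>

lemma eigenvector_in_range_of_certificate:
  fixes Q W :: "real^'n^'n"
  assumes Q: "Q \<in> psd" "Q \<noteq> 0" and neg: "\<And>y. y \<bullet> (W *v (Q *v y)) \<le> 0"
  obtains a b z where "a \<in> range ((*v) Q)" "b \<in> range ((*v) Q)" "a \<noteq> 0 \<or> b \<noteq> 0" "Re z \<le> 0"
    "W *v a = Re z *\<^sub>R a - Im z *\<^sub>R b" "W *v b = Im z *\<^sub>R a + Re z *\<^sub>R b"
proof -
  have sQ: "transpose Q = Q" and nn: "y \<bullet> (Q *v y) \<ge> 0" for y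
    using Q by (auto simp: psd_def)
  let ?S = "range ((*v) Q)"
  have S: "subspace ?S"
    by (intro linear_subspace_image matrix_vector_mul_linear subspace_UNIV)
  have kernel: "v \<bullet> (W *v (Q *v w)) = 0" if "Q *v v = 0" for v w
  proof -
    \<comment> \<open>As Q v = 0, the condition at w + r v is affine in r, so boundedness for all r
      kills the coefficient.\<close>
    have le: "r * (v \<bullet> (W *v (Q *v w))) \<le> - (w \<bullet> (W *v (Q *v w)))" for r
      using neg[of "w + r *\<^sub>R v"] that
      by (simp add: matrix_vector_right_distrib matrix_vector_mult_scaleR inner_add_left)
    let ?p = "v \<bullet> (W *v (Q *v w))" and ?q = "- (w \<bullet> (W *v (Q *v w)))"
    show ?thesis
      using le[of "(?q + 1) / ?p"] by (cases "?p = 0") auto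
  qed
  have inv: "W *v x \<in> ?S" if "x \<in> ?S" for x
  proof -
    obtain w where x: "x = Q *v w"
      using \<open>x \<in> range ((*v) Q)\<close> by auto
    \<comment> \<open>The component t orthogonal to the range lies in the kernel of Q, so t is
      orthogonal to W x and hence to itself.\<close>
    obtain s t where s: "s \<in> span ?S" and t: "\<And>y. y \<in> span ?S \<Longrightarrow> orthogonal t y"
      and st: "W *v x = s + t"
      using orthogonal_subspace_decomp_exists[of ?S "W *v x"] by metis
    have "(Q *v t) \<bullet> (Q *v t) = t \<bullet> (Q *v (Q *v t))"
      by (rule inner_symmetric_mult[OF sQ, symmetric])
    also have "\<dots> = 0"
      using t[OF span_base[OF rangeI]] by (simp add: orthogonal_def)
    finally have "t \<bullet> (W *v x) = 0"
      unfolding x by (intro kernel) simp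
    moreover have "t \<bullet> s = 0"
      using t[OF s] by (simp add: orthogonal_def)
    ultimately have "t = 0"
      by (simp add: st inner_add_right)
    then show ?thesis
      using s st S by (simp add: span_eq_iff[THEN iffD2])
  qed
  obtain y where "Q *v y \<noteq> 0"
    using Q(2) by (metis matrix_eq matrix_vector_mult_0)
  from real_invariant_subspace_eigenvector[OF S inv _ this]
  obtain a b z where ab: "a \<in> ?S" "b \<in> ?S" "a \<noteq> 0 \<or> b \<noteq> 0"
    and W: "W *v a = Re z *\<^sub>R a - Im z *\<^sub>R b" "W *v b = Im z *\<^sub>R a + Re z *\<^sub>R b"
    by blast
  from ab obtain c d where cd: "a = Q *v c" "b = Q *v d"
    by auto
  have "c \<bullet> (W *v a) + d \<bullet> (W *v b) \<le> 0"
    using neg[of c] neg[of d] by (simp add: cd)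
  also have "c \<bullet> (W *v a) + d \<bullet> (W *v b) = Re z * (c \<bullet> a + d \<bullet> b)"
  proof -
    have "c \<bullet> b = d \<bullet> a"
      unfolding cd using inner_symmetric_mult[OF sQ, of c d] by (simp add: inner_commute)
    then show ?thesis
      by (simp add: W inner_diff_right inner_add_right algebra_simps)
  qed
  finally have "Re z * (c \<bullet> a + d \<bullet> b) \<le> 0" .
  moreover have "c \<bullet> a + d \<bullet> b > 0"
  proof -
    have "c \<bullet> a \<ge> 0" "d \<bullet> b \<ge> 0" "c \<bullet> a = 0 \<Longrightarrow> a = 0" "d \<bullet> b = 0 \<Longrightarrow> b = 0"
      using nn psd_kernel[OF Q(1)] by (simp_all add: cd)
    then show ?thesis
      using ab(3) by (metis add_nonneg_pos add_pos_nonneg order_le_less)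
  qed
  ultimately have "Re z \<le> 0"
    by (metis mult_pos_pos not_le)
  with ab W show thesis
    using that by blast
qed

lemma transpose_diff: "transpose (M - N) = transpose M - transpose N"
  by (simp add: transpose_def vec_eq_iff)

lemma matrix_diff_ldistrib: "M ** (N - K) = M ** N - M ** K" for M :: "'a::ring_1^'m^'n"
  by (simp add: matrix_matrix_mult_def vec_eq_iff right_diff_distrib sum_subtractf)

lemma matrix_diff_rdistrib: "(M - N) ** K = M ** K - N ** K" for M :: "'a::ring_1^'m^'n"
  by (simp add: matrix_matrix_mult_def vec_eq_iff left_diff_distrib sum_subtractf)

text \<open>A left inverse G of D eliminates the equality constraint, leaving an unconstrained
  alternative for W and E. The eigenvector it provides is the state part of a zero
  direction.\<close>

lemma infeasible_imp_invariant_zero: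
  fixes A :: "real^'n^'n" and B :: "real^'m^'n" and C :: "real^'n^'p" and D :: "real^'m^'p"
  assumes D: "full_column_rank D"
    and infeasible: "\<nexists>X Y. X \<in> pd \<and> transpose B ** X + transpose D ** Y = 0 \<and> dual_lyap A C X Y \<in> pd"
  shows "\<exists>z. invariant_zero A B C D z \<and> Re z \<le> 0"
proof -
  obtain G where G: "G ** D = mat 1"
    using D left_inverse_iff_rank[of D] by (auto simp: full_column_rank_def)
  define W where "W = A - B ** G ** C"
  define E where "E = C - D ** G ** C"
  \<comment> \<open>\<open>Y = Z - G\<^sup>T (B\<^sup>T X + D\<^sup>T Z)\<close> parametrizes the solutions \<open>Y\<close> of the equality constraint by a free \<open>Z\<close>.\<close>
  have "\<nexists>X Z. X \<in> pd \<and> He (transpose W ** X + transpose E ** Z) \<in> pd"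
  proof (safe)
    fix X Z assume X: "X \<in> pd" and ly: "He (transpose W ** X + transpose E ** Z) \<in> pd"
    define U where "U = transpose B ** X + transpose D ** Z"
    define Y where "Y = Z - transpose G ** U"
    have "transpose D ** transpose G = mat 1"
      by (simp add: matrix_transpose_mul[symmetric] G)
    then have "transpose B ** X + transpose D ** Y = 0"
      by (simp add: Y_def U_def matrix_diff_ldistrib matrix_mul_assoc)
    moreover have "transpose A ** X + transpose C ** Y = transpose W ** X + transpose E ** Z"
      by (simp add: Y_def U_def W_def E_def matrix_diff_ldistrib matrix_diff_rdistrib transpose_diff
          matrix_add_ldistrib matrix_transpose_mul matrix_mul_assoc)
    ultimately show False
      using infeasible X ly unfolding dual_lyap_def by metis
  qed
  from lyapunov_alternative[OF this] obtain Q where Q: "Q \<in> psd" "Q \<noteq> 0" and EQ: "E ** Q = 0"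
    and neg: "\<And>y. y \<bullet> (W *v (Q *v y)) \<le> 0"
    by blast
  obtain a b z where ab: "a \<in> range ((*v) Q)" "b \<in> range ((*v) Q)" "a \<noteq> 0 \<or> b \<noteq> 0" "Re z \<le> 0"
    and W: "W *v a = Re z *\<^sub>R a - Im z *\<^sub>R b" "W *v b = Im z *\<^sub>R a + Re z *\<^sub>R b"
    using eigenvector_in_range_of_certificate[OF Q neg] by metis
  \<comment> \<open>The input -G C x turns the output into E x, which is 0 on the range of Q, and
    the state map into W x.\<close>
  have Ex: "C *v x + D *v (- (G *v (C *v x))) = 0" if "x \<in> range ((*v) Q)" for x
  proof -
    have "E *v x = 0"
      using that EQ by (auto simp: matrix_vector_mul_assoc)
    then show ?thesis
      by (simp add: E_def matrix_vector_mult_diff_rdistrib matrix_vector_mul_assoc[symmetric] vec.neg)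
  qed
  have Wx: "A *v x + B *v (- (G *v (C *v x))) = W *v x" for x
    by (simp add: W_def matrix_vector_mult_diff_rdistrib matrix_vector_mul_assoc[symmetric] vec.neg)
  have "invariant_zero A B C D z"
    unfolding invariant_zero_iff using ab(3) W Ex[OF ab(1)] Ex[OF ab(2)] Wx by metis
  with ab(4) show ?thesis
    by blast
qed

theorem theorem3p5:
  fixes A :: "real^'n^'n"
    and B1 :: "real^'m1^'n"
    and B2 :: "real^'m2^'n"
    and C1 :: "real^'n^'p1"
    and D11 :: "real^'m1^'p1"
    and D12 :: "real^'m2^'p1"
  assumes "full_column_rank (vcat B2 D12)"
  shows "(\<not> full_column_rank D12 \<longrightarrow> \<not> dual_strongly_feasible A B1 B2 C1 D11 D12) \<and>
         (full_column_rank D12 \<longrightarrow>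
           (\<not> dual_strongly_feasible A B1 B2 C1 D11 D12 \<longleftrightarrow>
            (\<exists>z. invariant_zero A B2 C1 D12 z \<and> Re z \<le> 0)))"
  unfolding dual_strongly_feasible_iff
  using feasible_imp_full_column_rank[OF assms] feasible_imp_Re_pos[OF assms]
    infeasible_imp_invariant_zero[of D12 B2 A C1]
  by (meson not_le)

end
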